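(* (a) For any tree $G=(V,E)$ on $n$ vertices and any labelling $L$ of $G$ that satisfies the property TC on $G$, the cost of $L$ satisfies $c(L)\ge 2n-3$. (b) Given any connected undirected graph $G=(V,E)$ on $n$ vertices, one can design a labelling $L$ of $G$ of cost $c(L)=2(n-1)$ that satisfies the property TC on $G$; such an $L$ can be computed in polynomial time.
   Context: A labelling of a graph $G=(V,E)$ is an assignment $L=\{L_e\subseteq\mathbb{N}^*:e\in E\}$ of sets of positive integers (labels) to edges (a set $L_e$ may be empty); $G(L)=(V,E,L)$ is the resulting temporal graph. The cost of $L$ is $c(L)=\sum_{e\in E}|L_e|$. A $(u,v)$-journey in $G(L)$ is a sequence $(u,u_1,l_1),(u_1,u_2,l_2),\ldots,(u_{k-1},v,l_k)$ in which each consecutive pair of vertices forms an edge $e$ of $G$ with the corresponding label in $L_e$, and $l_1<l_2<\cdots<l_k$ (undirected edges may be traversed in either direction). $L$ satisfies TC on $G$ (i.e. $G(L)$ is temporally connected) if for every ordered pair of distinct vertices $u,v\in V$ there is a $(u,v)$-journey in $G(L)$. *)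

theory Defs
  imports
    "HOL-Library.Extended_Nat"
    "HOL-Computational_Algebra.Polynomial"
begin

section \<open>Finite simple undirected graphs\<close>

definition simple_graph :: "'a set \<Rightarrow> 'a set set \<Rightarrow> bool" where
  "simple_graph V E \<longleftrightarrow> finite V \<and> (\<forall>e\<in>E. e \<subseteq> V \<and> card e = 2)"

definition connected_graph :: "'a set \<Rightarrow> 'a set set \<Rightarrow> bool" where
  "connected_graph V E \<longleftrightarrow>
     simple_graph V E \<and> V \<noteq> {} \<and> (\<forall>u\<in>V. \<forall>v\<in>V. (u, v) \<in> {(x, y). {x, y} \<in> E}\<^sup>*)"

definition is_cycle :: "'a set set \<Rightarrow> 'a list \<Rightarrow> bool" where
  "is_cycle E c \<longleftrightarrow>
     3 \<le> length c \<and> distinct c \<and> successively (\<lambda>x y. {x, y} \<in> E) c \<and> {last c, hd c} \<in> E"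

definition tree_graph :: "'a set \<Rightarrow> 'a set set \<Rightarrow> bool" where
  "tree_graph V E \<longleftrightarrow> connected_graph V E \<and> (\<nexists>c. is_cycle E c)"


section \<open>Labellings and temporal connectivity\<close>

text \<open>A labelling is a total function on vertex sets; only its values on edges are ever used.
  Label sets may be empty or infinite.\<close>

type_synonym 'a labelling = "'a set \<Rightarrow> nat set"

definition is_labelling :: "'a set set \<Rightarrow> 'a labelling \<Rightarrow> bool" where
  "is_labelling E L \<longleftrightarrow> (\<forall>e\<in>E. 0 \<notin> L e)"

text \<open>The cost is an extended natural because \<^const>\<open>card\<close> of an infinite set is 0.\<close>

definition labelling_cost :: "'a set set \<Rightarrow> 'a labelling \<Rightarrow> enat" where
  "labelling_cost E L = (\<Sum>e\<in>E. if finite (L e) then enat (card (L e)) else \<infinity>)"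

definition is_journey ::
  "'a set set \<Rightarrow> 'a labelling \<Rightarrow> 'a \<Rightarrow> 'a \<Rightarrow> ('a \<times> 'a \<times> nat) list \<Rightarrow> bool" where
  "is_journey E L u v J \<longleftrightarrow>
     J \<noteq> [] \<and> fst (hd J) = u \<and> fst (snd (last J)) = v \<and>
     (\<forall>(x, y, l) \<in> set J. {x, y} \<in> E \<and> l \<in> L {x, y}) \<and>
     successively (\<lambda>(x, y, l) (x', y', l'). y = x' \<and> l < l') J"

definition temporally_connected :: "'a set \<Rightarrow> 'a set set \<Rightarrow> 'a labelling \<Rightarrow> bool" where
  "temporally_connected V E L \<longleftrightarrow>
     (\<forall>u\<in>V. \<forall>v\<in>V. u \<noteq> v \<longrightarrow> (\<exists>J. is_journey E L u v J))"


section \<open>A machine model for polynomial time\<close>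

text \<open>A random access machine with structured control flow. A program refers to finitely many
  arrays of natural numbers, each array being named by a number; a scalar is cell 0 of an array.
  Every operation takes unit time. The only arithmetic is addition and truncated subtraction:
  each operation lengthens the binary representation of the largest number in play by O(1) bits,
  so that polynomially many steps are polynomial time on a Turing machine. (With unit-cost
  multiplication this would fail.)\<close>

type_synonym store = "nat \<Rightarrow> nat \<Rightarrow> nat"

datatype expr = Const nat | Read nat expr | Add expr expr | Sub expr expr

primrec expr_val :: "expr \<Rightarrow> store \<Rightarrow> nat" where
  "expr_val (Const k) s = k"
| "expr_val (Read a i) s = s a (expr_val i s)"
| "expr_val (Add x y) s = expr_val x s + expr_val y s"
| "expr_val (Sub x y) s = expr_val x s - expr_val y s"

primrec expr_time :: "expr \<Rightarrow> nat" where
  "expr_time (Const k) = 1"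
| "expr_time (Read a i) = expr_time i + 1"
| "expr_time (Add x y) = expr_time x + expr_time y + 1"
| "expr_time (Sub x y) = expr_time x + expr_time y + 1"

text \<open>\<open>Write a i x\<close> stores \<open>x\<close> in cell \<open>i\<close> of array \<open>a\<close>. A guard counts as true iff its
  value is nonzero.\<close>

datatype prog =
    Skip
  | Write nat expr expr
  | Seq prog prog
  | Cond expr prog prog
  | While expr prog

text \<open>\<open>exec c s t s'\<close>: started in \<open>s\<close>, the program \<open>c\<close> halts in \<open>s'\<close> after \<open>t\<close> time units.\<close>

inductive exec :: "prog \<Rightarrow> store \<Rightarrow> nat \<Rightarrow> store \<Rightarrow> bool" where
  Skip: "exec Skip s 1 s"
| Write: "exec (Write a i x) s (expr_time i + expr_time x + 1)
            (s(a := (s a)(expr_val i s := expr_val x s)))"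
| Seq: "exec c s t s' \<Longrightarrow> exec d s' t' s'' \<Longrightarrow> exec (Seq c d) s (t + t') s''"
| CondTrue: "expr_val b s \<noteq> 0 \<Longrightarrow> exec c s t s' \<Longrightarrow> exec (Cond b c d) s (expr_time b + t + 1) s'"
| CondFalse: "expr_val b s = 0 \<Longrightarrow> exec d s t s' \<Longrightarrow> exec (Cond b c d) s (expr_time b + t + 1) s'"
| WhileFalse: "expr_val b s = 0 \<Longrightarrow> exec (While b c) s (expr_time b + 1) s"
| WhileTrue: "expr_val b s \<noteq> 0 \<Longrightarrow> exec c s t s' \<Longrightarrow> exec (While b c) s' t' s'' \<Longrightarrow>
    exec (While b c) s (expr_time b + t + t' + 1) s''"

text \<open>Input: a graph on the vertices 0, ..., n - 1, with n in array 0 and the adjacency matrix,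
  row by row, in array 1; all other cells are 0.\<close>

definition graph_input :: "nat \<Rightarrow> nat set set \<Rightarrow> store" where
  "graph_input n E a i =
     (if a = 0 \<and> i = 0 then n
      else if a = 1 \<and> i < n * n \<and> {i div n, i mod n} \<in> E then 1
      else 0)"

text \<open>Output: a list of (edge, label) pairs, possibly with repetitions. Its length is in array 2;
  the i-th pair consists of the edge with end points in cell i of arrays 3 and 4, and of the label
  in cell i of array 5.\<close>

definition outputs_labelling :: "store \<Rightarrow> nat set set \<Rightarrow> nat labelling \<Rightarrow> bool" where
  "outputs_labelling s E L \<longleftrightarrow>
     (\<forall>i < s 2 0. {s 3 i, s 4 i} \<in> E) \<and>
     (\<forall>e\<in>E. L e = {s 5 i |i. i < s 2 0 \<and> {s 3 i, s 4 i} = e})"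

text \<open>One program and one polynomial serve all inputs. Bounding the time by a polynomial in n is
  the same as bounding it by a polynomial in the size of the adjacency matrix.\<close>

definition labelling_computable_in_poly_time ::
  "(nat set \<Rightarrow> nat set set \<Rightarrow> bool) \<Rightarrow> (nat set \<Rightarrow> nat set set \<Rightarrow> nat labelling \<Rightarrow> bool) \<Rightarrow> bool"
where
  "labelling_computable_in_poly_time Inst Sol \<longleftrightarrow>
     (\<exists>c p. \<forall>n E. Inst {0..<n} E \<longrightarrow>
        (\<exists>t s L. exec c (graph_input n E) t s \<and> t \<le> poly p n \<and>
                 outputs_labelling s E L \<and> Sol {0..<n} E L))"

end

theory Submission
  imports Defs
begin

text \<open>
  In a tree every edge is a bridge, hence carries a label. For two edges \<open>e\<close> and \<open>f\<close> let \<open>x\<close> be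
  the end of \<open>e\<close> away from \<open>f\<close> and \<open>w\<close> the end of \<open>f\<close> away from \<open>e\<close>. A journey from \<open>x\<close> to \<open>w\<close>
  uses \<open>e\<close> before \<open>f\<close>, one from \<open>w\<close> to \<open>x\<close> uses \<open>f\<close> before \<open>e\<close>; so \<open>e\<close> and \<open>f\<close> cannot both carry
  a single label, and all edges but one have two labels.

  Conversely, enumerate the vertices as \<open>v 0, \<dots>, v (n - 1)\<close> such that each \<open>v i\<close> with \<open>i > 0\<close> has
  a neighbour \<open>p i\<close> among its predecessors, and give the edge between \<open>p i\<close> and \<open>v i\<close> the labels
  \<open>n - i\<close> and \<open>n - 1 + i\<close>. The labels below \<open>n\<close> increase towards \<open>v 0\<close>, the others increase
  away from it, so that every journey can go through \<open>v 0\<close>. Such an enumeration is found by scanning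
  the adjacency matrix \<open>n\<close> times for edges that leave the set of vertices reached so far.
\<close>

section \<open>Reachability and bridges\<close>

abbreviation adj :: "'a set set \<Rightarrow> ('a \<times> 'a) set" where
  "adj E \<equiv> {(x, y). {x, y} \<in> E}"

lemma adj_rtrancl_sym: "(x, y) \<in> (adj E)\<^sup>* \<Longrightarrow> (y, x) \<in> (adj E)\<^sup>*"
proof -
  have "sym (adj E)" by (auto simp: sym_def insert_commute)
  then show "(x, y) \<in> (adj E)\<^sup>* \<Longrightarrow> (y, x) \<in> (adj E)\<^sup>*"
    by (meson sym_rtrancl symE)
qed

text \<open>Vertices are prepended one at a time; if the new one already occurs, the path is cut
  down to the suffix from that occurrence.\<close>

lemma rtrancl_distinct_path:
  assumes "(x, y) \<in> {(a, b). R a b}\<^sup>*"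
  obtains p where "p \<noteq> []" "hd p = x" "last p = y" "distinct p" "successively R p"
proof -
  have "\<exists>p. p \<noteq> [] \<and> hd p = x \<and> last p = y \<and> distinct p \<and> successively R p"
    using assms
  proof (induction rule: converse_rtrancl_induct)
    case base
    show ?case by (rule exI[of _ "[y]"]) simp
  next
    case (step x x')
    then obtain p where p: "p \<noteq> []" "hd p = x'" "last p = y" "distinct p" "successively R p"
      by blast
    show ?case
    proof (cases "x \<in> set p")
      case True
      then obtain q r where "p = q @ x # r" by (meson split_list)
      with p show ?thesis
        by (intro exI[of _ "x # r"]) (auto simp: successively_append_iff)
    next
      case False
      with p step(1) show ?thesis
        by (intro exI[of _ "x # p"]) (auto simp: successively_Cons)
    qed
  qed
  then show ?thesis using that by blast
qed

text \<open>A distinct path between the ends that avoids the edge is closed to a cycle by that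
  edge.\<close>

lemma acyclic_bridge:
  assumes "\<nexists>c. is_cycle E c" "{x, y} \<in> E" "x \<noteq> y"
  shows "(x, y) \<notin> (adj (E - {{x, y}}))\<^sup>*"
proof
  assume "(x, y) \<in> (adj (E - {{x, y}}))\<^sup>*"
  then obtain p where p: "p \<noteq> []" "hd p = x" "last p = y" "distinct p"
      "successively (\<lambda>a b. {a, b} \<in> E - {{x, y}}) p"
    by (rule rtrancl_distinct_path)
  \<comment> \<open>A shorter path would force \<open>x = y\<close> or consist of the deleted
    edge.\<close>
  have "3 \<le> length p"
  proof (rule ccontr)
    assume "\<not> 3 \<le> length p"
    then consider "p = [x]" | z where "p = [x, z]"
      using p(1,2) by (cases p; cases "tl p"; cases "tl (tl p)") auto
    then show False using p(3,5) assms(3) by cases auto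
  qed
  moreover have "successively (\<lambda>a b. {a, b} \<in> E) p"
    using p(5) by (rule successively_mono) auto
  ultimately have "is_cycle E p"
    using p assms(2) unfolding is_cycle_def by (auto simp: insert_commute)
  with assms(1) show False by blast
qed

text \<open>A path from inside \<open>S\<close> to outside has a step that leaves \<open>S\<close>.
  This drives both the existence of search orders and the progress of each matrix scan.\<close>

lemma connected_crossing_edge:
  assumes "connected_graph V E" "S \<subseteq> V" "S \<noteq> {}" "S \<noteq> V"
  obtains x y where "x \<in> S" "y \<in> V - S" "{x, y} \<in> E"
proof -
  obtain a b where "a \<in> S" "b \<in> V - S" using assms by blast
  with assms have "(a, b) \<in> (adj E)\<^sup>*" unfolding connected_graph_def by blast
  then have "b \<in> S \<or> (\<exists>x y. x \<in> S \<and> y \<in> V - S \<and> {x, y} \<in> E)"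
  proof (induction rule: rtrancl_induct)
    case base
    show ?case using \<open>a \<in> S\<close> by simp
  next
    case (step y z)
    have "z \<in> V" using step(2) assms(1) by (auto simp: connected_graph_def simple_graph_def)
    with step show ?case by blast
  qed
  with \<open>b \<in> V - S\<close> that show ?thesis by blast
qed

section \<open>The lower bound for trees\<close>

lemma is_journey_Cons:
  "is_journey E L u v ((x, y, l) # J) \<Longrightarrow> J \<noteq> [] \<Longrightarrow>
    u = x \<and> {x, y} \<in> E \<and> is_journey E L y v J"
  by (cases J) (auto simp: is_journey_def successively_Cons)

text \<open>The step \<open>s\<close> is singled out for two uses: as the last step of a journey,
  and as the step across one edge before which another edge must have been crossed.\<close>

lemma is_journey_prefix_reach:
  assumes "is_journey E L u v (J\<^sub>1 @ s # J\<^sub>2)" "\<forall>(x, y, l) \<in> set J\<^sub>1. {x, y} \<noteq> e"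
  shows "(u, fst s) \<in> (adj (E - {e}))\<^sup>*"
  using assms
proof (induction J\<^sub>1 arbitrary: u)
  case Nil
  then show ?case by (auto simp: is_journey_def)
next
  case (Cons t J\<^sub>1)
  obtain x y l where t: "t = (x, y, l)" by (cases t)
  have J: "u = x" "{x, y} \<in> E" "is_journey E L y v (J\<^sub>1 @ s # J\<^sub>2)"
    using is_journey_Cons[of E L u v x y l "J\<^sub>1 @ s # J\<^sub>2"] Cons.prems(1) t by auto
  then have "(y, fst s) \<in> (adj (E - {e}))\<^sup>*" using Cons.IH Cons.prems(2) by auto
  moreover have "(x, y) \<in> adj (E - {e})" using J Cons.prems(2) t by auto
  ultimately show ?case using J(1) by (meson converse_rtrancl_into_rtrancl)
qed

lemma is_journey_uses_edge:
  assumes "is_journey E L u v J" "(u, v) \<notin> (adj (E - {e}))\<^sup>*"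
  obtains x y l where "(x, y, l) \<in> set J" "{x, y} = e"
proof -
  have "\<not> (\<forall>(x, y, l) \<in> set J. {x, y} \<noteq> e)"
  proof
    assume *: "\<forall>(x, y, l) \<in> set J. {x, y} \<noteq> e"
    have "J \<noteq> []" using assms(1) by (simp add: is_journey_def)
    then obtain J' x y l where J: "J = J' @ [(x, y, l)]" by (metis rev_exhaust surj_pair)
    have "(u, x) \<in> (adj (E - {e}))\<^sup>*"
      using is_journey_prefix_reach[of E L u v J' "(x, y, l)" "[]" e] assms(1) * J by auto
    moreover have "(x, y) \<in> adj (E - {e})" "y = v"
      using assms(1) * J by (auto simp: is_journey_def)
    ultimately have "(u, v) \<in> (adj (E - {e}))\<^sup>*" by (meson rtrancl_into_rtrancl)
    with assms(2) show False by blast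
  qed
  then show ?thesis using that by blast
qed

lemma is_journey_labels_sorted:
  assumes "is_journey E L u v J"
  shows "sorted_wrt (<) (map (\<lambda>(x, y, l). l) J)"
proof -
  have "successively (<) (map (\<lambda>(x, y, l). l) J)"
    unfolding successively_map using assms
    by (auto simp: is_journey_def intro: successively_mono)
  then show ?thesis by (simp add: successively_conv_sorted_wrt)
qed

text \<open>Removing \<open>f\<close> separates \<open>x\<close> from \<open>w\<close>, so the
  journey crosses \<open>f\<close>. Both ends of \<open>f\<close> lie beyond \<open>e\<close> as
  seen from \<open>x\<close>, so \<open>e\<close> is crossed earlier, and labels increase.\<close>

lemma single_labels_less:
  assumes "is_journey E L x w J" "L e = {a}" "L f = {b}"
    and "(x, w) \<notin> (adj (E - {f}))\<^sup>*"
    and "\<And>z. z \<in> f \<Longrightarrow> (x, z) \<notin> (adj (E - {e}))\<^sup>*"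
  shows "a < b"
proof -
  obtain p q l where f: "(p, q, l) \<in> set J" "{p, q} = f"
    using is_journey_uses_edge[OF assms(1,4)] .
  then obtain J\<^sub>1 J\<^sub>2 where J: "J = J\<^sub>1 @ (p, q, l) # J\<^sub>2" by (meson split_list)
  have "(x, p) \<notin> (adj (E - {e}))\<^sup>*" using assms(5) f by blast
  then obtain p' q' l' where e: "(p', q', l') \<in> set J\<^sub>1" "{p', q'} = e"
    using is_journey_prefix_reach[of E L x w J\<^sub>1 "(p, q, l)" J\<^sub>2 e] assms(1) J by auto
  have "l' < l"
    using is_journey_labels_sorted[OF assms(1)] e(1) by (auto simp: J sorted_wrt_append)
  moreover have "l' = a" "l = b"
    using assms(1-3) e f J by (fastforce simp: is_journey_def)+
  ultimately show ?thesis by simp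
qed

text \<open>The edge \<open>{z, w}\<close> survives the removal of \<open>{x, y}\<close>, so its
  ends stay in one component, which cannot contain both \<open>x\<close> and
  \<open>y\<close>.\<close>

lemma bridge_far_end:
  assumes "{x, y} \<in> E" "{z, w} \<in> E" "{z, w} \<noteq> {x, y}" "(x, y) \<notin> (adj (E - {{x, y}}))\<^sup>*"
  obtains u where "u \<in> {x, y}" "\<And>t. t \<in> {z, w} \<Longrightarrow> (u, t) \<notin> (adj (E - {{x, y}}))\<^sup>*"
proof -
  let ?R = "(adj (E - {{x, y}}))\<^sup>*"
  have zw: "(z, w) \<in> ?R" using assms by blast
  have "\<not> ((x, z) \<in> ?R \<and> (y, z) \<in> ?R)"
    using assms(4) rtrancl_trans[of x z _ y] adj_rtrancl_sym[of y z] by blast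
  then obtain u where u: "u \<in> {x, y}" "(u, z) \<notin> ?R" by blast
  moreover have "(u, w) \<notin> ?R" using u(2) zw rtrancl_trans[of u w _ z] adj_rtrancl_sym[of z w] by blast
  ultimately show ?thesis using that by blast
qed

lemma simple_graph_edgeE:
  assumes "simple_graph V E" "e \<in> E"
  obtains x y where "e = {x, y}" "x \<noteq> y" "x \<in> V" "y \<in> V"
proof -
  have "card e = 2" "e \<subseteq> V" using assms unfolding simple_graph_def by auto
  then show ?thesis using that by (auto simp: card_2_iff)
qed

lemma simple_graph_finite_edges: "simple_graph V E \<Longrightarrow> finite E"
  unfolding simple_graph_def by (meson Pow_iff finite_Pow_iff finite_subset subsetI)

section \<open>Label counts in a temporally connected tree\<close>

lemma tree_labels_nonempty:
  assumes "tree_graph V E" "temporally_connected V E L" "e \<in> E"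
  shows "L e \<noteq> {}"
proof
  assume "L e = {}"
  have "simple_graph V E" using assms(1) by (simp add: tree_graph_def connected_graph_def)
  then obtain x y where e: "e = {x, y}" "x \<noteq> y" "x \<in> V" "y \<in> V"
    using assms(3) by (rule simple_graph_edgeE)
  then have bridge: "(x, y) \<notin> (adj (E - {e}))\<^sup>*"
    using acyclic_bridge[of E x y] assms(1,3) by (simp add: tree_graph_def)
  obtain J where J: "is_journey E L x y J"
    using assms(2) e unfolding temporally_connected_def by blast
  obtain p q l where "(p, q, l) \<in> set J" "{p, q} = e"
    using is_journey_uses_edge[OF J bridge] .
  with J \<open>L e = {}\<close> show False by (auto simp: is_journey_def)
qed

lemma tree_single_label_unique:
  assumes "tree_graph V E" "temporally_connected V E L"
    and "e \<in> E" "f \<in> E" "L e = {a}" "L f = {b}"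
  shows "e = f"
proof (rule ccontr)
  assume "e \<noteq> f"
  have G: "simple_graph V E" using assms(1) by (simp add: tree_graph_def connected_graph_def)
  obtain x y where e: "e = {x, y}" "x \<noteq> y" "x \<in> V" "y \<in> V"
    using G assms(3) by (rule simple_graph_edgeE)
  obtain z w where f: "f = {z, w}" "z \<noteq> w" "z \<in> V" "w \<in> V"
    using G assms(4) by (rule simple_graph_edgeE)
  have "(x, y) \<notin> (adj (E - {e}))\<^sup>*" "(z, w) \<notin> (adj (E - {f}))\<^sup>*"
    using acyclic_bridge[of E] assms(1,3,4) e f by (simp_all add: tree_graph_def)
  then obtain u t where u: "u \<in> e" "\<And>s. s \<in> f \<Longrightarrow> (u, s) \<notin> (adj (E - {e}))\<^sup>*"
    and t: "t \<in> f" "\<And>s. s \<in> e \<Longrightarrow> (t, s) \<notin> (adj (E - {f}))\<^sup>*"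
    using bridge_far_end[of x y E z w] bridge_far_end[of z w E x y] assms(3,4) e(1) f(1) \<open>e \<noteq> f\<close>
    by metis
  have ut: "(u, t) \<notin> (adj (E - {f}))\<^sup>*" "(t, u) \<notin> (adj (E - {e}))\<^sup>*"
    using u t adj_rtrancl_sym by metis+
  \<comment> \<open>Reachability is reflexive, so separated vertices differ.\<close>
  have "u \<noteq> t" "u \<in> V" "t \<in> V" using u t ut e f by auto
  then obtain J J' where J: "is_journey E L u t J" "is_journey E L t u J'"
    using assms(2) unfolding temporally_connected_def by metis
  have "a < b" using single_labels_less[OF J(1) assms(5,6) ut(1) u(2)] .
  moreover have "b < a" using single_labels_less[OF J(2) assms(6,5) ut(2) t(2)] .
  ultimately show False by simp
qed

lemma sum_enat: "(\<Sum>x\<in>A. enat (f x)) = enat (sum f A)"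
  by (induction A rule: infinite_finite_induct) (auto simp: zero_enat_def)

section \<open>Search orders\<close>

text \<open>For \<open>k > 0\<close>, the edges between \<open>p i\<close> and \<open>v i\<close>
  form a tree rooted at \<open>v 0\<close>, parents listed before children. Values from
  \<open>k\<close> on are free, so that the order grows by function update.\<close>

definition search_order ::
  "'a set set \<Rightarrow> nat \<Rightarrow> (nat \<Rightarrow> 'a) \<Rightarrow> (nat \<Rightarrow> 'a) \<Rightarrow> bool" where
  "search_order E k v p \<longleftrightarrow>
     inj_on v {..<k} \<and> (\<forall>i. 0 < i \<and> i < k \<longrightarrow> p i \<in> v ` {..<i} \<and> {p i, v i} \<in> E)"

lemma search_order_extend:
  assumes "search_order E k v p" "x \<in> v ` {..<k}" "y \<notin> v ` {..<k}" "{x, y} \<in> E"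
  shows "search_order E (Suc k) (v(k := y)) (p(k := x))"
proof -
  have "inj_on (v(k := y)) {..<Suc k}"
    using assms(1,3) by (auto simp: search_order_def inj_on_def less_Suc_eq image_iff)
  moreover have "(p(k := x)) i \<in> (v(k := y)) ` {..<i} \<and> {(p(k := x)) i, (v(k := y)) i} \<in> E"
    if "0 < i" "i < Suc k" for i
  proof -
    have "(v(k := y)) ` {..<i} = v ` {..<i}" using that by auto
    with that assms show ?thesis by (auto simp: search_order_def less_Suc_eq)
  qed
  ultimately show ?thesis unfolding search_order_def by blast
qed

lemma image_fun_upd_lessThan_Suc: "(v(k := y)) ` {..<Suc k} = insert y (v ` {..<k})"
  by (auto simp: lessThan_Suc)

lemma search_order_card: "search_order E k v p \<Longrightarrow> card (v ` {..<k}) = k"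
  by (simp add: search_order_def card_image)

text \<open>While fewer than \<open>card V\<close> vertices are listed, connectivity yields an edge
  leaving them, whose outer end is listed next.\<close>

lemma search_order_exists:
  assumes "connected_graph V E"
  obtains v p where "search_order E (card V) v p" "v ` {..<card V} = V"
proof -
  have fin: "finite V" and "V \<noteq> {}"
    using assms by (auto simp: connected_graph_def simple_graph_def)
  \<comment> \<open>The induction starts at 1 because a crossing edge exists only for a nonempty
    set.\<close>
  have "\<exists>v p. search_order E k v p \<and> v ` {..<k} \<subseteq> V" if "0 < k" "k \<le> card V" for k
    using that
  proof (induction k rule: nat_induct_non_zero)
    case 1
    obtain r where "r \<in> V" using \<open>V \<noteq> {}\<close> by blast
    then show ?case by (intro exI[of _ "\<lambda>_. r"]) (auto simp: search_order_def inj_on_def)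
  next
    case (Suc k)
    then obtain v p where vp: "search_order E k v p" "v ` {..<k} \<subseteq> V" by auto
    have "v ` {..<k} \<noteq> V" using search_order_card[OF vp(1)] Suc.prems by auto
    with Suc.hyps obtain x y where "x \<in> v ` {..<k}" "y \<in> V - v ` {..<k}" "{x, y} \<in> E"
      using connected_crossing_edge[OF assms vp(2)] by (metis image_is_empty lessThan_empty_iff not_gr0)
    then have "search_order E (Suc k) (v(k := y)) (p(k := x))"
        "(v(k := y)) ` {..<Suc k} \<subseteq> V"
      using search_order_extend[OF vp(1)] vp(2) unfolding image_fun_upd_lessThan_Suc by auto
    then show ?case by blast
  qed
  moreover have "0 < card V" using fin \<open>V \<noteq> {}\<close> by (simp add: card_gt_0_iff)
  ultimately obtain v p where "search_order E (card V) v p" "v ` {..<card V} \<subseteq> V" by blast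
  then show ?thesis using that card_subset_eq[OF fin] search_order_card by metis
qed

text \<open>The ends of the edge of index \<open>i\<close> have positions at most \<open>i\<close>,
  so \<open>v j\<close> with \<open>j > i\<close> is not among them.\<close>

lemma search_order_edges_inj:
  assumes "search_order E n v p"
  shows "inj_on (\<lambda>i. {p i, v i}) {1..<n}"
proof -
  have "{p i, v i} \<noteq> {p j, v j}" if "0 < i" "i < j" "j < n" for i j
  proof
    assume "{p i, v i} = {p j, v j}"
    moreover have "p i \<in> v ` {..<i}" using assms that by (simp add: search_order_def)
    ultimately obtain h where "h \<le> i" "v j = v h"
      by (metis doubleton_eq_iff imageE le_refl lessThan_iff less_imp_le)
    moreover have "inj_on v {..<n}" using assms by (simp add: search_order_def)
    ultimately have "j = h" using that inj_on_eq_iff[of v "{..<n}" j h] by simp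
    with \<open>h \<le> i\<close> that show False by simp
  qed
  then show ?thesis by (auto simp: inj_on_def) (metis Suc_le_lessD linorder_neqE_nat)+
qed

lemma search_order_card_edges:
  assumes "search_order E n v p" "finite E"
  shows "n - 1 \<le> card E"
proof -
  have "(\<lambda>i. {p i, v i}) ` {1..<n} \<subseteq> E" using assms(1) by (auto simp: search_order_def)
  then have "card {1..<n} \<le> card E"
    using card_inj_on_le[OF search_order_edges_inj[OF assms(1)]] assms(2) by blast
  then show ?thesis by simp
qed

lemma tree_labelling_cost_ge:
  assumes "tree_graph V E" "temporally_connected V E L"
  shows "enat (2 * card V - 3) \<le> labelling_cost E L"
proof -
  have conn: "connected_graph V E" using assms(1) by (simp add: tree_graph_def)
  then have fin: "finite E"
    using simple_graph_finite_edges by (auto simp: connected_graph_def)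
  obtain v p where "search_order E (card V) v p"
    using search_order_exists[OF conn] .
  then have cardE: "card V - 1 \<le> card E" using fin by (rule search_order_card_edges)
  let ?c = "\<lambda>e. if finite (L e) then enat (card (L e)) else \<infinity>"
  \<comment> \<open>\<open>e\<^sub>0\<close> is the edge with a single label if there is one, and
    arbitrary otherwise, possibly outside \<open>E\<close>.\<close>
  obtain e\<^sub>0 where e0: "\<And>e. e \<in> E \<Longrightarrow> e \<noteq> e\<^sub>0 \<Longrightarrow> card (L e) \<noteq> 1"
    using tree_single_label_unique[OF assms] by (metis card_1_singletonE)
  have "(\<Sum>e\<in>E. enat (if e = e\<^sub>0 then 1 else 2)) \<le> (\<Sum>e\<in>E. ?c e)"
  proof (rule sum_mono)
    fix e assume "e \<in> E"
    have "card (L e) \<noteq> 0" if "finite (L e)"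
      using that tree_labels_nonempty[OF assms \<open>e \<in> E\<close>] by simp
    then have "(if e = e\<^sub>0 then 1 else 2) \<le> card (L e)" if "finite (L e)"
      using that e0[OF \<open>e \<in> E\<close>] by (cases "e = e\<^sub>0") (auto simp: le_less_Suc_eq not_le numeral_2_eq_2 less_Suc_eq)
    then show "enat (if e = e\<^sub>0 then 1 else 2) \<le> ?c e" by simp
  qed
  moreover have "2 * card V - 3 \<le> (\<Sum>e\<in>E. if e = e\<^sub>0 then 1 else 2::nat)"
  proof -
    \<comment> \<open>Counting 2 for every edge exceeds the true summands by 1, at
      \<open>e\<^sub>0\<close> at most.\<close>
    have "2 * card E = (\<Sum>e\<in>E. (if e = e\<^sub>0 then 1 else 2) + (if e = e\<^sub>0 then 1 else 0::nat))"
      by (subst sum.cong[OF refl, of _ _ "\<lambda>_. 2"]) auto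
    also have "\<dots> \<le> (\<Sum>e\<in>E. if e = e\<^sub>0 then 1 else 2) + 1"
      using fin by (simp add: sum.distrib)
    finally show ?thesis using cardE by linarith
  qed
  ultimately show ?thesis
    unfolding labelling_cost_def sum_enat by (meson enat_ord_simps(1) order_trans)
qed

section \<open>The labelling of a search order\<close>

text \<open>The labels \<open>n - i\<close> fill 1 to \<open>n - 1\<close> and the labels
  \<open>n - 1 + i\<close> fill \<open>n\<close> to \<open>2 * n - 2\<close>: all are positive and
  the two phases do not overlap.\<close>

definition order_labelling :: "nat \<Rightarrow> (nat \<Rightarrow> 'a) \<Rightarrow> (nat \<Rightarrow> 'a) \<Rightarrow> 'a labelling" where
  "order_labelling n v p e =
     {l. \<exists>i. 0 < i \<and> i < n \<and> {p i, v i} = e \<and> (l = n - i \<or> l = n - 1 + i)}"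

lemma order_labelling_cost:
  assumes "search_order E n v p" "finite E"
  shows "labelling_cost E (order_labelling n v p) = enat (2 * (n - 1))"
proof -
  let ?L = "order_labelling n v p" and ?d = "\<lambda>i. {p i, v i}"
  note inj = search_order_edges_inj[OF assms(1)]
  \<comment> \<open>An edge determines its index, so no third label comes from another
    index.\<close>
  have L: "?L (?d i) = {n - i, n - 1 + i}" if "i \<in> {1..<n}" for i
  proof -
    have "(0 < j \<and> j < n \<and> ?d j = ?d i) = (j = i)" for j
      using inj_on_eq_iff[OF inj, of j i] that by auto
    then have "?L (?d i) = {l. \<exists>j. j = i \<and> (l = n - j \<or> l = n - 1 + j)}"
      unfolding order_labelling_def by (metis (no_types))
    then show ?thesis by auto
  qed
  have empty: "?L e = {}" if "e \<notin> ?d ` {1..<n}" for e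
    using that unfolding order_labelling_def by force
  have "finite (?L e)" for e
    using L empty by (cases "e \<in> ?d ` {1..<n}") auto
  then have "labelling_cost E ?L = enat (\<Sum>e\<in>E. card (?L e))"
    unfolding labelling_cost_def by (simp add: sum_enat)
  also have "(\<Sum>e\<in>E. card (?L e)) = (\<Sum>e\<in>?d ` {1..<n}. card (?L e))"
    using assms empty by (intro sum.mono_neutral_right) (auto simp: search_order_def)
  also have "\<dots> = (\<Sum>i\<in>{1..<n}. card (?L (?d i)))"
    using inj by (simp add: sum.reindex)
  also have "\<dots> = (\<Sum>i\<in>{1..<n}. 2)"
  proof (rule sum.cong)
    fix i assume i: "i \<in> {1..<n}"
    then have "n - i \<noteq> n - 1 + i" by auto
    with L[OF i] show "card (?L (?d i)) = 2" by simp
  qed simp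
  finally show ?thesis by simp
qed

text \<open>Allowing \<open>u = v\<close>, for which there is no journey, makes concatenation uniform.\<close>

definition journey_within ::
  "'a set set \<Rightarrow> 'a labelling \<Rightarrow> nat \<Rightarrow> nat \<Rightarrow> 'a \<Rightarrow> 'a \<Rightarrow> bool" where
  "journey_within E L a b u v \<longleftrightarrow>
     u = v \<or> (\<exists>J. is_journey E L u v J \<and> (\<forall>(x, y, l) \<in> set J. a \<le> l \<and> l \<le> b))"

lemma journey_within_edge:
  "{x, y} \<in> E \<Longrightarrow> l \<in> L {x, y} \<Longrightarrow> journey_within E L l l x y"
  unfolding journey_within_def is_journey_def
  by (intro disjI2 exI[of _ "[(x, y, l)]"]) auto

lemma journey_within_mono:
  "journey_within E L a b u v \<Longrightarrow> a' \<le> a \<Longrightarrow> b \<le> b' \<Longrightarrow> journey_within E L a' b' u v"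
  unfolding journey_within_def by fastforce

lemma journey_within_trans:
  assumes "journey_within E L a b u v" "journey_within E L c d v w" "b < c" "a \<le> c" "b \<le> d"
  shows "journey_within E L a d u w"
proof (cases "u = v \<or> v = w")
  \<comment> \<open>If one half is trivial, the other half remains, with its label window
    widened.\<close>
  case True
  then show ?thesis using assms journey_within_mono by (metis order_refl)
next
  case False
  then obtain J K where J: "is_journey E L u v J" "\<forall>(x, y, l) \<in> set J. a \<le> l \<and> l \<le> b"
    and K: "is_journey E L v w K" "\<forall>(x, y, l) \<in> set K. c \<le> l \<and> l \<le> d"
    using assms unfolding journey_within_def by auto
  have "last J \<in> set J" "hd K \<in> set K" using J K by (auto simp: is_journey_def)
  then have "case (last J, hd K) of ((x, y, l), (x', y', l')) \<Rightarrow> y = x' \<and> l < l'"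
    using J K assms(3) by (fastforce simp: is_journey_def split: prod.splits)
  then have "is_journey E L u w (J @ K)"
    using J(1) K(1) by (auto simp: is_journey_def successively_append_iff)
  moreover have "\<forall>(x, y, l) \<in> set (J @ K). a \<le> l \<and> l \<le> d"
    using J(2) K(2) assms(4,5) by fastforce
  ultimately show ?thesis unfolding journey_within_def by blast
qed

text \<open>Induction along the parent \<open>v j\<close>, where \<open>j < i\<close>: the upward
  journey starts with \<open>n - i\<close>, below all labels used from \<open>v j\<close> on; the
  downward one ends with \<open>n - 1 + i\<close>, above all labels used before.\<close>

lemma order_labelling_journeys:
  assumes "search_order E n v p" "i < n"
  shows "journey_within E (order_labelling n v p) (n - i) (n - 1) (v i) (v 0)" (is "?up i")
    and "journey_within E (order_labelling n v p) n (n - 1 + i) (v 0) (v i)" (is "?down i")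
proof -
  let ?L = "order_labelling n v p"
  have "?up i \<and> ?down i" using assms(2)
  proof (induction i rule: less_induct)
    case (less i)
    show ?case
    proof (cases "i = 0")
      \<comment> \<open>Here both windows run from \<open>n\<close> to \<open>n - 1\<close> and are
        empty; the alternative \<open>u = v\<close> applies.\<close>
      case True
      then show ?thesis by (simp add: journey_within_def)
    next
      case False
      with less.prems assms(1) obtain j where j: "j < i" "p i = v j" "{p i, v i} \<in> E"
        unfolding search_order_def by blast
      have IH: "?up j" "?down j" using less.IH[of j] less.prems j by auto
      have "n - i \<in> ?L {p i, v i}" "n - 1 + i \<in> ?L {p i, v i}"
        using False less.prems unfolding order_labelling_def by auto
      then have e: "journey_within E ?L (n - i) (n - i) (v i) (v j)"
          "journey_within E ?L (n - 1 + i) (n - 1 + i) (v j) (v i)"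
        using j journey_within_edge[of _ _ E _ ?L] by (simp_all add: insert_commute)
      have "?up i"
        by (rule journey_within_trans[OF e(1) IH(1)]) (use j less.prems in auto)
      moreover have "?down i"
        by (rule journey_within_trans[OF IH(2) e(2)]) (use j less.prems in auto)
      ultimately show ?thesis ..
    qed
  qed
  then show "?up i" "?down i" by auto
qed

lemma order_labelling_connected:
  assumes "search_order E n v p"
  shows "temporally_connected (v ` {..<n}) E (order_labelling n v p)"
  unfolding temporally_connected_def
proof (intro ballI impI)
  let ?L = "order_labelling n v p"
  fix x y assume "x \<in> v ` {..<n}" "y \<in> v ` {..<n}" "x \<noteq> y"
  then obtain i j where ij: "i < n" "j < n" "x = v i" "y = v j" by auto
  have "journey_within E ?L (n - i) (n - 1 + j) x y"
    unfolding ij(3,4)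
    by (rule journey_within_trans[OF order_labelling_journeys(1)[OF assms ij(1)]
          order_labelling_journeys(2)[OF assms ij(2)]]) (use ij in auto)
  with \<open>x \<noteq> y\<close> show "\<exists>J. is_journey E ?L x y J" unfolding journey_within_def by blast
qed

lemma order_labelling_is_labelling: "is_labelling E (order_labelling n v p)"
  unfolding is_labelling_def order_labelling_def by auto

lemma order_labelling_solution:
  assumes "connected_graph V E" "search_order E n v p" "v ` {..<n} = V"
  shows "is_labelling E (order_labelling n v p)"
    and "labelling_cost E (order_labelling n v p) = enat (2 * (card V - 1))"
    and "temporally_connected V E (order_labelling n v p)"
proof -
  have "finite E"
    using assms(1) simple_graph_finite_edges by (auto simp: connected_graph_def)
  moreover have "card V = n" using search_order_card[OF assms(2)] assms(3) by simp
  ultimately show "labelling_cost E (order_labelling n v p) = enat (2 * (card V - 1))"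
    using order_labelling_cost[OF assms(2)] by simp
  show "temporally_connected V E (order_labelling n v p)"
    using order_labelling_connected[OF assms(2)] assms(3) by simp
qed (rule order_labelling_is_labelling)

section \<open>Computing a search order\<close>

lemma exec_Skip_iff: "exec Skip s t s' \<longleftrightarrow> t = 1 \<and> s' = s"
  using exec.Skip by (auto elim: exec.cases)

lemma exec_Write_iff:
  "exec (Write a i x) s t s' \<longleftrightarrow>
    t = expr_time i + expr_time x + 1 \<and> s' = s(a := (s a)(expr_val i s := expr_val x s))"
  using exec.Write by (auto elim: exec.cases)

lemma exec_Seq_iff:
  "exec (Seq c d) s t s' \<longleftrightarrow> (\<exists>t\<^sub>1 t\<^sub>2 s''. exec c s t\<^sub>1 s'' \<and> exec d s'' t\<^sub>2 s' \<and> t = t\<^sub>1 + t\<^sub>2)"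
  by (rule iffI, erule exec.cases) (auto intro: exec.Seq)

text \<open>Existence of an execution includes termination; \<open>T\<close> is only an upper bound,
  so that both branches of a conditional can share it.\<close>

definition runs :: "prog \<Rightarrow> nat \<Rightarrow> (store \<Rightarrow> bool) \<Rightarrow> store \<Rightarrow> bool" where
  "runs c T Q s \<longleftrightarrow> (\<exists>t s'. exec c s t s' \<and> t \<le> T \<and> Q s')"

lemma runs_weaken:
  "runs c T Q s \<Longrightarrow> T \<le> T' \<Longrightarrow> (\<And>s'. Q s' \<Longrightarrow> Q' s') \<Longrightarrow> runs c T' Q' s"
  unfolding runs_def by (meson order_trans)

lemma runs_Cond:
  assumes "expr_val b s \<noteq> 0 \<Longrightarrow> runs c T Q s" "expr_val b s = 0 \<Longrightarrow> runs d T Q s"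
  shows "runs (Cond b c d) (expr_time b + T + 1) Q s"
proof (cases "expr_val b s = 0")
  case True
  with assms(2) show ?thesis
    unfolding runs_def by (meson CondFalse add_le_mono1 add_le_cancel_left)
next
  case False
  with assms(1) show ?thesis
    unfolding runs_def by (meson CondTrue add_le_mono1 add_le_cancel_left)
qed

text \<open>The index of the invariant counts finished rounds, so it fixes when the guard fails. The
  bound adds \<open>N\<close> rounds with their tests and one failing test.\<close>

lemma runs_While:
  assumes step: "\<And>i s. i < N \<Longrightarrow> I i s \<Longrightarrow> expr_val b s \<noteq> 0 \<and> runs c T (I (Suc i)) s"
    and stop: "\<And>s. I N s \<Longrightarrow> expr_val b s = 0"
    and init: "I 0 s"
  shows "runs (While b c) (N * (T + expr_time b + 1) + (expr_time b + 1)) (I N) s"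
proof -
  \<comment> \<open>Generalised to a start in round \<open>i\<close>, for induction on the remaining
    rounds.\<close>
  have "runs (While b c) ((N - i) * (T + expr_time b + 1) + (expr_time b + 1)) (I N) s"
    if "i \<le> N" "I i s" for i s
    using that
  proof (induction "N - i" arbitrary: i s)
    case 0
    then show ?case using WhileFalse[OF stop] by (auto simp: runs_def)
  next
    case (Suc m)
    then have "i < N" by simp
    from step[OF this Suc.prems(2)] obtain t s'
      where b: "expr_val b s \<noteq> 0" and c: "exec c s t s'" "t \<le> T" "I (Suc i) s'"
      unfolding runs_def by blast
    have m: "m = N - Suc i" using Suc.hyps(2) by simp
    obtain t' s'' where w: "exec (While b c) s' t' s''"
        "t' \<le> m * (T + expr_time b + 1) + (expr_time b + 1)" "I N s''"
      using Suc.hyps(1)[OF m _ c(3)] \<open>i < N\<close> m unfolding runs_def by auto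
    have "expr_time b + t + t' + 1 \<le> Suc m * (T + expr_time b + 1) + (expr_time b + 1)"
      using c(2) w(2) by simp
    then show ?case
      using WhileTrue[OF b c(1) w(1)] w(3) Suc.hyps(2) unfolding runs_def by metis
  qed
  from this[of 0 s] init show ?thesis by simp
qed

definition block :: "prog list \<Rightarrow> prog" where
  "block cs = foldr Seq cs Skip"

lemma runs_block_Nil: "runs (block []) T Q s \<longleftrightarrow> 1 \<le> T \<and> Q s"
  by (auto simp: runs_def block_def exec_Skip_iff)

text \<open>An equation, so that simplification executes straight-line code symbolically and deducts
  each cost from the budget.\<close>

lemma runs_block_Write:
  "runs (block (Write a i x # cs)) T Q s \<longleftrightarrow>
    expr_time i + expr_time x + 1 \<le> T \<and>
    runs (block cs) (T - (expr_time i + expr_time x + 1)) Q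
      (s(a := (s a)(expr_val i s := expr_val x s)))"
  by (fastforce simp: runs_def block_def exec_Seq_iff exec_Write_iff)

lemma runs_block_Cons:
  assumes "runs c T\<^sub>1 R s" "\<And>s'. R s' \<Longrightarrow> runs (block cs) T\<^sub>2 Q s'"
  shows "runs (block (c # cs)) (T\<^sub>1 + T\<^sub>2) Q s"
proof -
  obtain t\<^sub>1 s' where c: "exec c s t\<^sub>1 s'" "t\<^sub>1 \<le> T\<^sub>1" "R s'"
    using assms(1) unfolding runs_def by blast
  then obtain t\<^sub>2 s'' where "exec (block cs) s' t\<^sub>2 s''" "t\<^sub>2 \<le> T\<^sub>2" "Q s''"
    using assms(2) unfolding runs_def by blast
  with c show ?thesis
    unfolding runs_def block_def
    by (intro exI[of _ "t\<^sub>1 + t\<^sub>2"] exI[of _ s'']) (auto intro: exec.Seq)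
qed

section \<open>The search program\<close>

abbreviation var :: "nat \<Rightarrow> expr" where
  "var a \<equiv> Read a (Const 0)"

abbreviation assign :: "nat \<Rightarrow> expr \<Rightarrow> prog" where
  "assign a x \<equiv> Write a (Const 0) x"

text \<open>Besides the arrays of the input and output convention, array 6 holds the characteristic
  function of the set of reached vertices, 7 their number, 8 the number of completed scans of the
  matrix, 9 and 10 the current row and column, and 11 the position of this entry in the matrix.\<close>

definition crossing_test :: expr where
  "crossing_test =
     Sub (Add (Read 1 (var 11)) (Read 6 (var 9))) (Add (Const 1) (Read 6 (var 10)))"

text \<open>On entry array 7 holds the index \<open>k\<close> of the new vertex, so the labels are
  \<open>n - k\<close> and \<open>n + (k - 1)\<close>.\<close>

definition add_edge :: prog where
  "add_edge = block
     [Write 3 (var 2) (var 9),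
      Write 4 (var 2) (var 10),
      Write 5 (var 2) (Sub (var 0) (var 7)),
      assign 2 (Add (var 2) (Const 1)),
      Write 3 (var 2) (var 9),
      Write 4 (var 2) (var 10),
      Write 5 (var 2) (Add (var 0) (Sub (var 7) (Const 1))),
      assign 2 (Add (var 2) (Const 1)),
      Write 6 (var 10) (Const 1),
      assign 7 (Add (var 7) (Const 1))]"

text \<open>The position is incremented along with the column because the machine cannot multiply;
  it passes from row to row without a reset.\<close>

definition scan_entry :: prog where
  "scan_entry = block
     [Cond crossing_test add_edge Skip,
      assign 10 (Add (var 10) (Const 1)),
      assign 11 (Add (var 11) (Const 1))]"

definition scan_row :: prog where
  "scan_row = block
     [While (Sub (var 0) (var 10)) scan_entry,
      assign 10 (Const 0),
      assign 9 (Add (var 9) (Const 1))]"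

definition scan_matrix :: prog where
  "scan_matrix = block
     [While (Sub (var 0) (var 9)) scan_row,
      assign 9 (Const 0),
      assign 11 (Const 0),
      assign 8 (Add (var 8) (Const 1))]"

definition search_prog :: prog where
  "search_prog = block
     [assign 6 (Const 1),
      assign 7 (Const 1),
      While (Sub (var 0) (var 8)) scan_matrix]"

section \<open>Invariant of the partial output\<close>

text \<open>Output cells \<open>2 * (i - 1)\<close> and \<open>2 * (i - 1) + 1\<close> belong to
  index \<open>i\<close>, recovered as \<open>Suc (j div 2)\<close>; thus \<open>n + j div 2\<close>
  is \<open>n - 1 + i\<close>.\<close>

definition search_state ::
  "nat \<Rightarrow> nat set set \<Rightarrow> nat \<Rightarrow> (nat \<Rightarrow> nat) \<Rightarrow> (nat \<Rightarrow> nat) \<Rightarrow> store \<Rightarrow> bool" where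
  "search_state n E k v p s \<longleftrightarrow>
     0 < k \<and> search_order E k v p \<and> v 0 = 0 \<and> v ` {..<k} \<subseteq> {..<n} \<and>
     s 0 0 = n \<and> s 1 = graph_input n E 1 \<and> s 7 0 = k \<and>
     (\<forall>u. s 6 u = of_bool (u \<in> v ` {..<k})) \<and>
     s 2 0 = 2 * (k - 1) \<and>
     (\<forall>j < 2 * (k - 1). s 3 j = p (Suc (j div 2)) \<and> s 4 j = v (Suc (j div 2)) \<and>
        s 5 j = (if even j then n - Suc (j div 2) else n + j div 2))"

text \<open>61 is the exact cost, including the closing \<open>Skip\<close> of the block.\<close>

lemma add_edge_runs:
  "runs add_edge 61
     (\<lambda>s'. s' = s(3 := (s 3)(s 2 0 := s 9 0, Suc (s 2 0) := s 9 0),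
        4 := (s 4)(s 2 0 := s 10 0, Suc (s 2 0) := s 10 0),
        5 := (s 5)(s 2 0 := s 0 0 - s 7 0, Suc (s 2 0) := s 0 0 + (s 7 0 - 1)),
        2 := (s 2)(0 := s 2 0 + 2),
        6 := (s 6)(s 10 0 := 1),
        7 := (s 7)(0 := s 7 0 + 1))) s"
  by (simp add: add_edge_def runs_block_Write runs_block_Nil fun_eq_iff)

lemma add_edge_search_state:
  assumes "search_state n E k v p s" "x \<in> v ` {..<k}" "y \<notin> v ` {..<k}" "y < n" "{x, y} \<in> E"
    and "s 9 0 = x" "s 10 0 = y"
  shows "runs add_edge 61
    (\<lambda>s'. search_state n E (Suc k) (v(k := y)) (p(k := x)) s' \<and> (\<forall>a\<in>{8,9,10,11}. s' a = s a)) s"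
proof (rule runs_weaken[OF add_edge_runs order_refl])
  fix s' assume s': "s' = s(3 := (s 3)(s 2 0 := s 9 0, Suc (s 2 0) := s 9 0),
        4 := (s 4)(s 2 0 := s 10 0, Suc (s 2 0) := s 10 0),
        5 := (s 5)(s 2 0 := s 0 0 - s 7 0, Suc (s 2 0) := s 0 0 + (s 7 0 - 1)),
        2 := (s 2)(0 := s 2 0 + 2),
        6 := (s 6)(s 10 0 := 1),
        7 := (s 7)(0 := s 7 0 + 1))"
  let ?v = "v(k := y)" and ?p = "p(k := x)"
  note st = assms(1)[unfolded search_state_def]
  have k: "0 < k" and m: "s 2 0 = 2 * (k - 1)" using st by auto
  have img: "?v ` {..<Suc k} = insert y (v ` {..<k})" by (rule image_fun_upd_lessThan_Suc)
  have "s' 3 j = ?p (Suc (j div 2)) \<and> s' 4 j = ?v (Suc (j div 2)) \<and>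
      s' 5 j = (if even j then n - Suc (j div 2) else n + j div 2)" if "j < 2 * k" for j
  proof -
    \<comment> \<open>Old cells have indices below \<open>k\<close>, untouched by the updates at
      \<open>k\<close>; the two new cells have index \<open>k\<close>.\<close>
    have "j < 2 * (k - 1) \<or> j = 2 * (k - 1) \<or> j = Suc (2 * (k - 1))"
      using that k by arith
    then consider "j < 2 * (k - 1)" | "j = 2 * (k - 1)" | "j = Suc (2 * (k - 1))"
      by blast
    then show ?thesis
    proof cases
      case 1
      then have "Suc (j div 2) < k" by linarith
      with 1 st m show ?thesis unfolding s' by simp
    next
      case 2
      with st m k assms(6,7) show ?thesis unfolding s' by simp
    next
      case 3
      then have "Suc (j div 2) = k" "odd j" using k by auto
      with 3 st m k assms(6,7) show ?thesis unfolding s' by auto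
    qed
  qed
  moreover have "search_order E (Suc k) ?v ?p"
    using st assms(2,3,5) by (intro search_order_extend) auto
  moreover have "s' 6 u = of_bool (u \<in> ?v ` {..<Suc k})" for u
    using st assms(7) unfolding img s' by simp
  moreover have "s' 2 0 = 2 * k" using k m unfolding s' by simp
  moreover have "?v ` {..<Suc k} \<subseteq> {..<n}" using st assms(4) unfolding img by simp
  ultimately have "search_state n E (Suc k) ?v ?p s'"
    using st unfolding search_state_def by (simp add: s')
  then show "search_state n E (Suc k) ?v ?p s' \<and> (\<forall>a\<in>{8,9,10,11}. s' a = s a)"
    by (simp add: s')
qed

lemma search_state_cong:
  assumes "search_state n E k v p s" "\<And>a. a \<le> 7 \<Longrightarrow> s' a = s a"
  shows "search_state n E k v p s'"
  using assms(1) unfolding search_state_def by (simp add: assms(2))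

definition reached :: "nat \<Rightarrow> nat set set \<Rightarrow> nat set \<Rightarrow> store \<Rightarrow> bool" where
  "reached n E D s \<longleftrightarrow> (\<exists>k v p. search_state n E k v p s \<and> D = v ` {..<k})"

lemma reached_cong: "reached n E D s \<Longrightarrow> (\<And>a. a \<le> 7 \<Longrightarrow> s' a = s a) \<Longrightarrow> reached n E D s'"
  unfolding reached_def using search_state_cong by blast

lemma reachedD:
  assumes "reached n E D s"
  shows "s 0 0 = n" "s 1 = graph_input n E 1" "s 6 u = of_bool (u \<in> D)" "D \<subseteq> {..<n}" "0 \<in> D"
  using assms unfolding reached_def search_state_def by (auto intro!: image_eqI[of 0 _ 0])

text \<open>The three values read are 0 or 1: two of them sum to more than 1 plus the third exactly
  if they are 1 and the third is 0.\<close>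

lemma crossing_test_val:
  assumes "reached n E D s" "x < n" "y < n"
    and "s 9 0 = x" "s 10 0 = y" "s 11 0 = x * n + y"
  shows "expr_val crossing_test s \<noteq> 0 \<longleftrightarrow> x \<in> D \<and> y \<notin> D \<and> {x, y} \<in> E"
proof -
  \<comment> \<open>The position lies inside the matrix, where \<open>div\<close> and
    \<open>mod\<close> recover row and column.\<close>
  have "x * n + y < Suc x * n" using assms(3) by simp
  also have "\<dots> \<le> n * n" using assms(2) by (intro mult_right_mono) auto
  finally have "s 1 (x * n + y) = of_bool ({x, y} \<in> E)"
    unfolding reachedD(2)[OF assms(1)] using assms(3) by (simp add: graph_input_def)
  then show ?thesis
    using assms(4-6) by (simp add: crossing_test_def reachedD(3)[OF assms(1)])
qed

section \<open>The nested scan loops\<close>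

text \<open>The state of a scan just before the entry in row \<open>x\<close> and column \<open>y\<close>, where \<open>D\<^sub>0\<close> is
  the set of vertices that had been reached when the scan began.\<close>

definition scan_state ::
  "nat \<Rightarrow> nat set set \<Rightarrow> nat set \<Rightarrow> nat \<Rightarrow> nat \<Rightarrow> nat \<Rightarrow> store \<Rightarrow> bool" where
  "scan_state n E D\<^sub>0 r x y s \<longleftrightarrow>
     s 8 0 = r \<and> s 9 0 = x \<and> s 10 0 = y \<and> s 11 0 = x * n + y \<and>
     (\<exists>D. reached n E D s \<and> D\<^sub>0 \<subseteq> D \<and>
        (\<forall>x' y'. (x' < x \<or> x' = x \<and> y' < y) \<and> x' \<in> D\<^sub>0 \<and> {x', y'} \<in> E \<longrightarrow> y' \<in> D))"

text \<open>Neighbours are guaranteed only for rows in \<open>D\<^sub>0\<close>: the row of a vertex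
  reached during the scan may already have been passed.\<close>

lemma scan_entry_runs:
  assumes "scan_state n E D\<^sub>0 r x y s" "x < n" "y < n"
  shows "runs scan_entry 100 (scan_state n E D\<^sub>0 r x (Suc y)) s"
proof -
  from assms(1) obtain D where D: "reached n E D s" "D\<^sub>0 \<subseteq> D"
      "\<And>x' y'. (x' < x \<or> x' = x \<and> y' < y) \<and> x' \<in> D\<^sub>0 \<and> {x', y'} \<in> E \<Longrightarrow> y' \<in> D"
    and s: "s 8 0 = r" "s 9 0 = x" "s 10 0 = y" "s 11 0 = x * n + y"
    unfolding scan_state_def by blast
  note test = crossing_test_val[OF D(1) assms(2,3) s(2-4)]
  \<comment> \<open>One expression serves both branches, as inserting a reached \<open>y\<close>
    changes nothing.\<close>
  let ?D = "if x \<in> D \<and> {x, y} \<in> E then insert y D else D"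
  let ?R = "\<lambda>s'. reached n E ?D s' \<and> (\<forall>a\<in>{8,9,10,11}. s' a = s a)"
  have "runs (Cond crossing_test add_edge Skip) (expr_time crossing_test + 61 + 1) ?R s"
  proof (rule runs_Cond)
    assume "expr_val crossing_test s \<noteq> 0"
    then have e: "x \<in> D" "y \<notin> D" "{x, y} \<in> E" using test by auto
    obtain k v p where st: "search_state n E k v p s" "D = v ` {..<k}"
      using D(1) unfolding reached_def by blast
    show "runs add_edge 61 ?R s"
    proof (rule runs_weaken[OF add_edge_search_state[OF st(1) _ _ assms(3) e(3) s(2,3)]])
      fix s' assume s': "search_state n E (Suc k) (v(k := y)) (p(k := x)) s' \<and>
        (\<forall>a\<in>{8,9,10,11}. s' a = s a)"
      have "?D = (v(k := y)) ` {..<Suc k}"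
        unfolding image_fun_upd_lessThan_Suc using e st(2) by simp
      with s' show "?R s'" unfolding reached_def by blast
    qed (use e st(2) in auto)
  next
    assume "expr_val crossing_test s = 0"
    then have "?D = D" using test by auto
    with D(1) show "runs Skip 61 ?R s" by (auto simp: runs_def exec_Skip_iff)
  qed
  then show ?thesis
    unfolding scan_entry_def
  proof (rule runs_weaken[OF runs_block_Cons])
    fix s' assume R: "?R s'"
    let ?s = "s'(10 := (s' 10)(0 := Suc y), 11 := (s' 11)(0 := Suc (x * n + y)))"
    have "reached n E ?D ?s" using R by (auto intro: reached_cong)
    moreover have "D\<^sub>0 \<subseteq> ?D" using D(2) by auto
    moreover have "y' \<in> ?D"
      if "(x' < x \<or> x' = x \<and> y' < Suc y) \<and> x' \<in> D\<^sub>0 \<and> {x', y'} \<in> E" for x' y'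
      using that D(2,3) by (auto simp: less_Suc_eq)
    ultimately have "scan_state n E D\<^sub>0 r x (Suc y) ?s"
      using R s unfolding scan_state_def by auto
    then show "runs (block [assign 10 (Add (var 10) (Const 1)), assign 11 (Add (var 11) (Const 1))])
        20 (scan_state n E D\<^sub>0 r x (Suc y)) s'"
      using R s by (simp add: runs_block_Write runs_block_Nil)
  qed (simp_all add: crossing_test_def)
qed

lemma scan_stateD:
  assumes "scan_state n E D\<^sub>0 r x y s"
  shows "s 0 0 = n" "s 8 0 = r" "s 9 0 = x" "s 10 0 = y" "s 11 0 = x * n + y"
  using assms reachedD(1) unfolding scan_state_def by blast+

lemma scan_row_runs:
  assumes "simple_graph {0..<n} E" "scan_state n E D\<^sub>0 r x 0 s" "x < n"
  shows "runs scan_row (106 * n + 26) (scan_state n E D\<^sub>0 r (Suc x) 0) s"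
proof -
  let ?b = "Sub (var 0) (var 10)"
  \<comment> \<open>The guard costs 5, hence 106 per round and 6 for the failing test; the
    assignments afterwards are granted 20.\<close>
  have "runs (While ?b scan_entry)
      (n * (100 + expr_time ?b + 1) + (expr_time ?b + 1)) (scan_state n E D\<^sub>0 r x n) s"
  proof (rule runs_While[where I = "scan_state n E D\<^sub>0 r x"])
    fix y s assume "y < n" "scan_state n E D\<^sub>0 r x y s"
    then show "expr_val ?b s \<noteq> 0 \<and> runs scan_entry 100 (scan_state n E D\<^sub>0 r x (Suc y)) s"
      using scan_entry_runs assms(3) by (simp add: scan_stateD)
  next
    fix s assume "scan_state n E D\<^sub>0 r x n s"
    then show "expr_val ?b s = 0"
      by (simp add: scan_stateD)
  qed (use assms(2) in simp)
  then show ?thesis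
    unfolding scan_row_def
  proof (rule runs_weaken[OF runs_block_Cons])
    fix s assume st: "scan_state n E D\<^sub>0 r x n s"
    let ?s = "s(10 := (s 10)(0 := 0), 9 := (s 9)(0 := Suc x))"
    from st obtain D where D: "reached n E D s" "D\<^sub>0 \<subseteq> D"
      "\<And>x' y'. (x' < x \<or> x' = x \<and> y' < n) \<and> x' \<in> D\<^sub>0 \<and> {x', y'} \<in> E \<Longrightarrow> y' \<in> D"
      unfolding scan_state_def by blast
    have "reached n E D ?s" using D(1) by (auto intro: reached_cong)
    moreover have "y' \<in> D" if "x' < Suc x \<and> x' \<in> D\<^sub>0 \<and> {x', y'} \<in> E" for x' y'
    proof -
      have "y' < n" using that assms(1) unfolding simple_graph_def by fastforce
      with that D(3) show ?thesis by (auto simp: less_Suc_eq)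
    qed
    ultimately have "scan_state n E D\<^sub>0 r (Suc x) 0 ?s"
      using st D(2) unfolding scan_state_def by auto
    then show "runs (block [assign 10 (Const 0), assign 9 (Add (var 9) (Const 1))])
        20 (scan_state n E D\<^sub>0 r (Suc x) 0) s"
      using st by (simp add: runs_block_Write runs_block_Nil scan_state_def)
  qed simp_all
qed

text \<open>\<open>Suc r\<close> counts the root, reached before any scan; \<open>min\<close> covers
  rounds after all vertices are reached.\<close>

definition round_state :: "nat \<Rightarrow> nat set set \<Rightarrow> nat \<Rightarrow> store \<Rightarrow> bool" where
  "round_state n E r s \<longleftrightarrow>
     s 8 0 = r \<and> s 9 0 = 0 \<and> s 10 0 = 0 \<and> s 11 0 = 0 \<and>
     (\<exists>D. reached n E D s \<and> min n (Suc r) \<le> card D)"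

lemma scan_matrix_runs:
  assumes "connected_graph {0..<n} E" "round_state n E r s"
  shows "runs scan_matrix (n * (106 * n + 32) + 32) (round_state n E (Suc r)) s"
proof -
  let ?b = "Sub (var 0) (var 9)"
  have G: "simple_graph {0..<n} E" using assms(1) by (simp add: connected_graph_def)
  obtain D\<^sub>0 where D0: "reached n E D\<^sub>0 s" "min n (Suc r) \<le> card D\<^sub>0"
    using assms(2) unfolding round_state_def by blast
  have "runs (While ?b scan_row)
      (n * (106 * n + 26 + expr_time ?b + 1) + (expr_time ?b + 1)) (scan_state n E D\<^sub>0 r n 0) s"
  proof (rule runs_While[where I = "\<lambda>x. scan_state n E D\<^sub>0 r x 0"])
    fix x s assume "x < n" "scan_state n E D\<^sub>0 r x 0 s"
    then show "expr_val ?b s \<noteq> 0 \<and> runs scan_row (106 * n + 26) (scan_state n E D\<^sub>0 r (Suc x) 0) s"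
      using scan_row_runs[OF G] by (simp add: scan_stateD)
  next
    fix s assume "scan_state n E D\<^sub>0 r n 0 s"
    then show "expr_val ?b s = 0"
      by (simp add: scan_stateD)
  next
    show "scan_state n E D\<^sub>0 r 0 0 s"
      using assms(2) D0(1) unfolding scan_state_def round_state_def by auto
  qed
  then show ?thesis
    unfolding scan_matrix_def
  proof (rule runs_weaken[OF runs_block_Cons])
    fix s assume st: "scan_state n E D\<^sub>0 r n 0 s"
    let ?s = "s(9 := (s 9)(0 := 0), 11 := (s 11)(0 := 0), 8 := (s 8)(0 := Suc r))"
    from st obtain D where D: "reached n E D s" "D\<^sub>0 \<subseteq> D"
      "\<And>x' y'. x' < n \<and> x' \<in> D\<^sub>0 \<and> {x', y'} \<in> E \<Longrightarrow> y' \<in> D"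
      unfolding scan_state_def by blast
    have sub: "D\<^sub>0 \<subseteq> {0..<n}" "0 \<in> D\<^sub>0" "D \<subseteq> {0..<n}"
      using reachedD[OF D0(1)] reachedD[OF D(1)] by auto
    \<comment> \<open>A full scan adds all neighbours of \<open>D\<^sub>0\<close>, and connectivity
      supplies a new one unless everything was reached.\<close>
    have "min n (Suc (Suc r)) \<le> card D"
    proof (cases "D\<^sub>0 = {0..<n}")
      case True
      with sub D(2) have "D = {0..<n}" by auto
      then show ?thesis by simp
    next
      case False
      then obtain x y where "x \<in> D\<^sub>0" "y \<in> {0..<n} - D\<^sub>0" "{x, y} \<in> E"
        using connected_crossing_edge[OF assms(1) sub(1)] sub(2) by blast
      then have "D\<^sub>0 \<subset> D" using D(2,3) sub(1) by fastforce
      then have "card D\<^sub>0 < card D"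
        using sub(3) by (meson finite_atLeastLessThan finite_subset psubset_card_mono)
      with D0(2) show ?thesis by linarith
    qed
    moreover have "reached n E D ?s" using D(1) by (auto intro: reached_cong)
    ultimately have "round_state n E (Suc r) ?s"
      using st unfolding round_state_def scan_state_def by auto
    then show "runs (block [assign 9 (Const 0), assign 11 (Const 0), assign 8 (Add (var 8) (Const 1))])
        20 (round_state n E (Suc r)) s"
      using st by (simp add: runs_block_Write runs_block_Nil scan_state_def)
  qed (simp_all add: algebra_simps)
qed

lemma search_prog_runs:
  assumes "connected_graph {0..<n} E"
  shows "runs search_prog (n * (n * (106 * n + 32) + 38) + 26)
    (\<lambda>s. \<exists>v p. search_state n E n v p s) (graph_input n E)"
proof -
  have "0 < n" using assms by (auto simp: connected_graph_def)
  let ?b = "Sub (var 0) (var 8)"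
  let ?T = "n * (n * (106 * n + 32) + 32 + expr_time ?b + 1) + (expr_time ?b + 1)"
  let ?Q = "\<lambda>s. \<exists>v p. search_state n E n v p s"
  have bound: "s 0 0 = n" if "round_state n E r s" for r s
    using that reachedD(1) unfolding round_state_def by blast
  let ?s = "(graph_input n E)(6 := (graph_input n E 6)(0 := 1), 7 := (graph_input n E 7)(0 := 1))"
  \<comment> \<open>The order consisting of the root 0 alone, with empty output.\<close>
  have "search_state n E 1 (\<lambda>_. 0) (\<lambda>_. 0) ?s"
    using \<open>0 < n\<close> by (auto simp: search_state_def search_order_def graph_input_def inj_on_def)
  then have "reached n E {0} ?s" unfolding reached_def by fastforce
  then have "round_state n E 0 ?s"
    unfolding round_state_def by (auto simp: graph_input_def intro!: exI[of _ "{0}"])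
  then have "runs (While ?b scan_matrix) ?T (round_state n E n) ?s"
  proof (rule runs_While[where I = "round_state n E", rotated 2])
    fix r s assume "r < n" "round_state n E r s"
    moreover from this have "s 8 0 = r" by (simp add: round_state_def)
    ultimately show "expr_val ?b s \<noteq> 0 \<and>
        runs scan_matrix (n * (106 * n + 32) + 32) (round_state n E (Suc r)) s"
      using scan_matrix_runs[OF assms] bound[of r s] by simp
  next
    fix s assume "round_state n E n s"
    moreover from this have "s 8 0 = n" by (simp add: round_state_def)
    ultimately show "expr_val ?b s = 0" using bound[of n s] by simp
  qed
  then have loop: "runs (block [While ?b scan_matrix]) (?T + 1) ?Q ?s"
  proof (rule runs_block_Cons)
    fix s assume "round_state n E n s"
    \<comment> \<open>After \<open>n\<close> rounds at least \<open>n\<close> vertices are reached,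
      and all are below \<open>n\<close>; so \<open>k = n\<close>.\<close>
    then obtain k v p where st: "search_state n E k v p s" "n \<le> card (v ` {..<k})"
      unfolding round_state_def reached_def by auto
    then have "card (v ` {..<k}) = k" "card (v ` {..<k}) \<le> card {..<n}"
      unfolding search_state_def by (blast intro: search_order_card card_mono finite_lessThan)+
    with st have "k = n" by simp
    with st(1) show "runs (block []) 1 ?Q s" by (auto simp: runs_block_Nil)
  qed
  \<comment> \<open>The two initial assignments cost 3 each.\<close>
  have "runs (block [While ?b scan_matrix])
      (n * (n * (106 * n + 32) + 38) + 26 - 3 - 3) ?Q ?s"
    by (rule runs_weaken[OF loop]) (simp_all add: algebra_simps)
  then show ?thesis
    by (simp add: search_prog_def runs_block_Write)
qed

section \<open>From the final store to polynomial time\<close>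

lemma search_state_outputs:
  assumes "search_state n E n v p s"
  shows "outputs_labelling s E (order_labelling n v p)"
proof -
  note st = assms[unfolded search_state_def]
  have n: "0 < n" and m: "s 2 0 = 2 * (n - 1)" using st by auto
  have out: "s 3 j = p (Suc (j div 2))" "s 4 j = v (Suc (j div 2))"
      "s 5 j = (if even j then n - Suc (j div 2) else n + j div 2)"
    and idx: "0 < Suc (j div 2)" "Suc (j div 2) < n" if "j < s 2 0" for j
    using st that by auto
  have edge: "{p i, v i} \<in> E" if "0 < i" "i < n" for i
    using st that by (simp add: search_order_def)
  have "order_labelling n v p e = {s 5 j |j. j < s 2 0 \<and> {s 3 j, s 4 j} = e}" (is "?L = ?R") for e
  proof (intro equalityI subsetI)
    fix l assume "l \<in> ?L"
    then obtain i where i: "0 < i" "i < n" "{p i, v i} = e" "l = n - i \<or> l = n - 1 + i"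
      unfolding order_labelling_def by blast
    \<comment> \<open>Of the two cells of index \<open>i\<close>, the even one holds
      \<open>n - i\<close> and the odd one \<open>n - 1 + i\<close>.\<close>
    define j where "j = (if l = n - i then 2 * (i - 1) else Suc (2 * (i - 1)))"
    have "j < s 2 0" "Suc (j div 2) = i" "even j \<longleftrightarrow> l = n - i"
      using i m by (auto simp: j_def)
    with i out[of j] show "l \<in> ?R" by (auto intro!: exI[of _ j])
  next
    fix l assume "l \<in> ?R"
    then obtain j where j: "l = s 5 j" "j < s 2 0" "{s 3 j, s 4 j} = e" by blast
    with out[of j] idx[of j] show "l \<in> ?L"
      unfolding order_labelling_def by (auto intro!: exI[of _ "Suc (j div 2)"])
  qed
  moreover have "{s 3 j, s 4 j} \<in> E" if "j < s 2 0" for j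
    using edge[OF idx[OF that]] out[OF that] by simp
  ultimately show ?thesis unfolding outputs_labelling_def by blast
qed

lemma order_labelling_computable:
  "labelling_computable_in_poly_time connected_graph
     (\<lambda>V E L. is_labelling E L \<and> labelling_cost E L = enat (2 * (card V - 1)) \<and>
              temporally_connected V E L)"
  unfolding labelling_computable_in_poly_time_def
proof (rule exI, rule exI, intro allI impI)
  fix n and E :: "nat set set" assume G: "connected_graph {0..<n} E"
  obtain t s v p where run: "exec search_prog (graph_input n E) t s"
      "t \<le> n * (n * (106 * n + 32) + 38) + 26"
    and st: "search_state n E n v p s"
    using search_prog_runs[OF G] unfolding runs_def by blast
  have so: "search_order E n v p" and sub: "v ` {..<n} \<subseteq> {0..<n}"
    using st unfolding search_state_def by auto
  have "v ` {..<n} = {0..<n}"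
    using card_subset_eq[OF _ sub] search_order_card[OF so] by simp
  note sol = order_labelling_solution[OF G so this]
  \<comment> \<open>The expanded bound, constant coefficient first.\<close>
  have "t \<le> poly [:26, 38, 32, 106:] n" using run(2) by (simp add: algebra_simps)
  with run(1) search_state_outputs[OF st] sol
  show "\<exists>t s L. exec search_prog (graph_input n E) t s \<and> t \<le> poly [:26, 38, 32, 106:] n \<and>
      outputs_labelling s E L \<and>
      (is_labelling E L \<and> labelling_cost E L = enat (2 * (card {0..<n} - 1)) \<and>
       temporally_connected {0..<n} E L)"
    by blast
qed

theorem theorem2:
  "(\<forall>(V :: 'a set) E L.
      tree_graph V E \<and> is_labelling E L \<and> temporally_connected V E L \<longrightarrow>
        enat (2 * card V - 3) \<le> labelling_cost E L) \<and>
   (\<forall>(V :: 'a set) E.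
      connected_graph V E \<longrightarrow>
        (\<exists>L. is_labelling E L \<and> labelling_cost E L = enat (2 * (card V - 1)) \<and>
             temporally_connected V E L)) \<and>
   labelling_computable_in_poly_time connected_graph
     (\<lambda>V E L. is_labelling E L \<and> labelling_cost E L = enat (2 * (card V - 1)) \<and>
              temporally_connected V E L)"
proof (intro conjI allI impI)
  fix V :: "'a set" and E L
  assume "tree_graph V E \<and> is_labelling E L \<and> temporally_connected V E L"
  then show "enat (2 * card V - 3) \<le> labelling_cost E L" using tree_labelling_cost_ge by blast
next
  fix V :: "'a set" and E
  assume "connected_graph V E"
  then show "\<exists>L. is_labelling E L \<and> labelling_cost E L = enat (2 * (card V - 1)) \<and>
      temporally_connected V E L"
    using search_order_exists order_labelling_solution by metis
qed (rule order_labelling_computable)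

end
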